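(* Let $\mathbb{F}$ be a field, $d\ge 0$ an integer, and $R\in\mathrm{Mat}_{d+1}(\mathbb{F})$ an invertible matrix. For $0\le i\le d$ define $E_i=\Delta_{i,i}$ and $E^*_i=R\Delta_{i,i}R^{-1}$. The following are equivalent: (i) the sequence $(\{E_i\}_{i=0}^d;\{E^*_i\}_{i=0}^d)$ is an idempotent system in $\mathrm{Mat}_{d+1}(\mathbb{F})$; (ii) the matrix $R$ is solid.
   Context: $\mathrm{Mat}_{d+1}(\mathbb{F})$ is the algebra of $(d+1)\times(d+1)$ matrices over $\mathbb{F}$, with rows and columns indexed by $0,1,\ldots,d$. $\Delta_{i,i}$ is the matrix with $(i,i)$-entry $1$ and all other entries $0$. A system of mutually orthogonal rank $1$ idempotents in $\mathrm{Mat}_{d+1}(\mathbb{F})$ is a sequence $\{E_i\}_{i=0}^d$ with $E_iE_j = \delta_{i,j}E_i$ and $\mathrm{rank}(E_i)=1$ for $0\le i,j\le d$. An idempotent system in $\mathrm{Mat}_{d+1}(\mathbb{F})$ is a sequence $(\{E_i\}_{i=0}^d; \{E^*_i\}_{i=0}^d)$ such that (i) $\{E_i\}_{i=0}^d$ and (ii) $\{E^*_i\}_{i=0}^d$ are systems of mutually orthogonal rank $1$ idempotents in $\mathrm{Mat}_{d+1}(\mathbb{F})$; (iii) $E_0E^*_iE_0 \neq 0$ for $0\le i\le d$; (iv) $E^*_0E_iE^*_0\neq 0$ for $0\le i\le d$. An invertible $R\in\mathrm{Mat}_{d+1}(\mathbb{F})$ is solid if for both $R$ and $R^{-1}$ all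 entries in column $0$ and in row $0$ are nonzero. *)

theory Defs
  imports "Jordan_Normal_Form.DL_Rank" "Jordan_Normal_Form.Gauss_Jordan_Elimination"
begin

text \<open>
  \<open>Mat\<^bsub>d+1\<^esub>(F)\<close> is \<^term>\<open>carrier_mat (Suc d) (Suc d)\<close>; matrix indices run from 0,
  so the row and column indices are \<open>0, \<dots>, d\<close>.  A sequence indexed by \<open>0, \<dots>, d\<close> is a
  function on the naturals of which only the values at \<open>i \<le> d\<close> matter.
\<close>

definition Delta :: "nat \<Rightarrow> nat \<Rightarrow> 'a::field mat" where
  "Delta d i = mat (Suc d) (Suc d) (\<lambda>(r, s). if r = i \<and> s = i then 1 else 0)"

text \<open>Only meaningful for invertible matrices, where it is the two-sided inverse by the lemma below.\<close>

definition mat_inv :: "'a::field mat \<Rightarrow> 'a mat" where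
  "mat_inv A = the (mat_inverse A)"

lemma mat_inv:
  fixes A :: "'a::field mat"
  assumes A: "A \<in> carrier_mat n n" and inv: "invertible_mat A"
  shows "mat_inv A \<in> carrier_mat n n" "A * mat_inv A = 1\<^sub>m n" "mat_inv A * A = 1\<^sub>m n"
proof -
  from inv obtain B where B: "A * B = 1\<^sub>m n" "B * A = 1\<^sub>m (dim_row B)"
    using A unfolding invertible_mat_def inverts_mat_def by auto
  have "dim_col (A * B) = n" "dim_col (B * A) = dim_row B"
    unfolding B by simp_all
  with A have "B \<in> carrier_mat n n" by auto
  with A B have "A \<in> Units (ring_mat TYPE('a) n ())"
    unfolding Units_def ring_mat_def by auto
  then obtain C where C: "mat_inverse A = Some C"
    using mat_inverse(1)[OF A, of "()"] by (cases "mat_inverse A") simp_all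
  then show "mat_inv A \<in> carrier_mat n n" "A * mat_inv A = 1\<^sub>m n" "mat_inv A * A = 1\<^sub>m n"
    using mat_inverse(2)[OF A C] by (simp_all add: mat_inv_def)
qed

definition orth_rank1_idempotents :: "nat \<Rightarrow> (nat \<Rightarrow> 'a::field mat) \<Rightarrow> bool" where
  "orth_rank1_idempotents d E \<longleftrightarrow>
     (\<forall>i\<le>d. E i \<in> carrier_mat (Suc d) (Suc d)) \<and>
     (\<forall>i\<le>d. \<forall>j\<le>d. E i * E j = (if i = j then E i else 0\<^sub>m (Suc d) (Suc d))) \<and>
     (\<forall>i\<le>d. vec_space.rank (Suc d) (E i) = 1)"

definition idempotent_system ::
    "nat \<Rightarrow> (nat \<Rightarrow> 'a::field mat) \<Rightarrow> (nat \<Rightarrow> 'a mat) \<Rightarrow> bool" where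
  "idempotent_system d E Es \<longleftrightarrow>
     orth_rank1_idempotents d E \<and>
     orth_rank1_idempotents d Es \<and>
     (\<forall>i\<le>d. E 0 * Es i * E 0 \<noteq> 0\<^sub>m (Suc d) (Suc d)) \<and>
     (\<forall>i\<le>d. Es 0 * E i * Es 0 \<noteq> 0\<^sub>m (Suc d) (Suc d))"

definition solid :: "nat \<Rightarrow> 'a::field mat \<Rightarrow> bool" where
  "solid d R \<longleftrightarrow>
     R \<in> carrier_mat (Suc d) (Suc d) \<and> invertible_mat R \<and>
     (\<forall>i\<le>d. R $$ (i, 0) \<noteq> 0 \<and> R $$ (0, i) \<noteq> 0) \<and>
     (\<forall>i\<le>d. mat_inv R $$ (i, 0) \<noteq> 0 \<and> mat_inv R $$ (0, i) \<noteq> 0)"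

end

theory Submission
  imports Defs
begin

text \<open>
  Both sequences are conjugates of the diagonal matrix units, so they are always systems of
  mutually orthogonal rank 1 idempotents. With \<open>S\<close> the inverse of \<open>R\<close>, the two remaining
  products are \<open>E\<^sub>0 E\<^sup>*\<^sub>i E\<^sub>0 = R\<^sub>0\<^sub>i S\<^sub>i\<^sub>0 E\<^sub>0\<close> and \<open>E\<^sup>*\<^sub>0 E\<^sub>i E\<^sup>*\<^sub>0 = S\<^sub>0\<^sub>i R\<^sub>i\<^sub>0 E\<^sup>*\<^sub>0\<close>, so their
  nonvanishing for all \<open>i\<close> is exactly solidity.
\<close>

text \<open>A nonzero entry lies in a nonzero column, and that column alone is a linearly
  independent set of columns, so its cardinality 1 bounds the rank from below.\<close>

lemma (in vec_space) rank_pos: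
  assumes A: "A \<in> carrier_mat n nc" and nz: "A \<noteq> 0\<^sub>m n nc"
  shows "0 < rank A"
proof -
  from nz A obtain r c where rc: "r < n" "c < nc" "A $$ (r, c) \<noteq> 0"
    by (metis carrier_matD eq_matI index_zero_mat)
  define v where "v = col A c"
  have v: "v \<in> carrier_vec n" "v \<noteq> 0\<^sub>v n" "v \<in> set (cols A)"
    using A rc by (auto simp: v_def cols_def dest!: arg_cong[where f = "\<lambda>v. v $ r"])
  have "lin_indpt {v}"
  proof
    assume "lin_dep {v}"
    then obtain a where a: "lincomb a {v} = 0\<^sub>v n" "a v \<noteq> 0"
      using finite_lin_dep[of "{v}"] v(1) by auto
    have "lincomb a {v} = a v \<cdot>\<^sub>v v"
      using v(1) by (simp add: lincomb_def)
    moreover have "(a v \<cdot>\<^sub>v v) $ r \<noteq> 0"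
      using A rc a(2) by (simp add: v_def)
    ultimately show False
      using a(1) rc(1) by (metis index_zero_vec(1))
  qed
  then show ?thesis
    using rank_ge_card_indpt[OF A, of "{v}"] v(3) by simp
qed

lemma Delta_carrier [simp]: "Delta d i \<in> carrier_mat (Suc d) (Suc d)"
  by (simp add: Delta_def)

lemma Delta_neq_0: "i \<le> d \<Longrightarrow> Delta d i \<noteq> 0\<^sub>m (Suc d) (Suc d)"
  by (auto simp: Delta_def dest!: arg_cong[where f = "\<lambda>A. A $$ (i, i)"])

text \<open>\<open>P * Delta d i\<close> keeps only column \<open>i\<close> of \<open>P\<close>, so
  the product is the outer product of that column with row \<open>i\<close> of \<open>Q\<close>.
  This yields both the bound 1 on the rank and the corner entries \<open>(0, 0)\<close> needed
  later.\<close>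

lemma mult_Delta_mult:
  assumes P: "P \<in> carrier_mat (Suc d) (Suc d)" and Q: "Q \<in> carrier_mat (Suc d) (Suc d)"
    and i: "i \<le> d"
  shows "P * Delta d i * Q = mat (Suc d) (Suc d) (\<lambda>(r, s). P $$ (r, i) * Q $$ (i, s))"
proof -
  have *: "P * Delta d i = mat (Suc d) (Suc d) (\<lambda>(r, s). if s = i then P $$ (r, i) else 0)"
    using P i by (intro eq_matI)
      (auto simp: Delta_def scalar_prod_def if_distrib cong: if_cong)
  show ?thesis
    unfolding * using Q i
    by (intro eq_matI)
      (auto simp: scalar_prod_def if_distrib[where f = "\<lambda>x. x * _"] cong: if_cong)
qed

lemma Delta_mult_Delta:
  assumes A: "A \<in> carrier_mat (Suc d) (Suc d)" and "i \<le> d" "j \<le> d"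
  shows "Delta d i * A * Delta d j =
    mat (Suc d) (Suc d) (\<lambda>(r, s). if r = i \<and> s = j then A $$ (i, j) else 0)"
proof -
  have *: "Delta d i * A = mat (Suc d) (Suc d) (\<lambda>(r, s). if r = i then A $$ (i, s) else 0)"
    using assms by (intro eq_matI)
      (auto simp: Delta_def scalar_prod_def if_distrib[where f = "\<lambda>x. x * _"] cong: if_cong)
  show ?thesis
    unfolding * using assms
    by (intro eq_matI) (auto simp: Delta_def scalar_prod_def if_distrib cong: if_cong)
qed

lemma Delta_mult_Delta_eq_0_iff:
  assumes "A \<in> carrier_mat (Suc d) (Suc d)" "i \<le> d" "j \<le> d"
  shows "Delta d i * A * Delta d j = 0\<^sub>m (Suc d) (Suc d) \<longleftrightarrow> A $$ (i, j) = 0"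
  using assms
  by (auto simp: Delta_mult_Delta mat_eq_iff)

text \<open>Multiplying by \<open>Q\<close> on the left and \<open>P\<close> on the right recovers
  \<open>A\<close>. This serves to strip outer factors \<open>R\<close> and \<open>S\<close> when
  only vanishing matters.\<close>

lemma mult_eq_0_iff_of_inverses:
  fixes A :: "'a::field mat"
  assumes carr: "A \<in> carrier_mat n n" "P \<in> carrier_mat n n" "Q \<in> carrier_mat n n"
    and inv: "P * Q = 1\<^sub>m n" "Q * P = 1\<^sub>m n"
  shows "P * A * Q = 0\<^sub>m n n \<longleftrightarrow> A = 0\<^sub>m n n"
proof
  assume 0: "P * A * Q = 0\<^sub>m n n"
  have "A = (Q * P) * A * (Q * P)"
    using carr by (simp add: inv)
  also have "\<dots> = Q * (P * A * Q) * P"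
    using carr by (simp add: assoc_mult_mat[of _ n n _ n _ n])
  also have "\<dots> = 0\<^sub>m n n"
    using carr by (simp add: 0)
  finally show "A = 0\<^sub>m n n" .
qed (use carr in simp)

text \<open>Reassociation that isolates \<open>A * B\<close>; when \<open>A\<close> and
  \<open>B\<close> cancel, products of conjugates reduce to products of the \<open>Delta\<close>
  matrices.\<close>

lemma mult_Delta_mult_Delta:
  assumes "A \<in> carrier_mat (Suc d) (Suc d)" "B \<in> carrier_mat (Suc d) (Suc d)"
    "P \<in> carrier_mat (Suc d) (Suc d)" "Q \<in> carrier_mat (Suc d) (Suc d)"
  shows "(P * Delta d i * A) * (B * Delta d j * Q) = P * (Delta d i * (A * B) * Delta d j) * Q"
  using assms
  by (simp add: assoc_mult_mat[of _ "Suc d" "Suc d" _ "Suc d" _ "Suc d"]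
      mult_carrier_mat[of _ "Suc d" "Suc d" _ "Suc d"])

lemma orth_rank1_idempotents_conjugate_Delta:
  fixes P Q :: "'a::field mat"
  assumes P: "P \<in> carrier_mat (Suc d) (Suc d)" and Q: "Q \<in> carrier_mat (Suc d) (Suc d)"
    and inv: "P * Q = 1\<^sub>m (Suc d)" "Q * P = 1\<^sub>m (Suc d)"
  shows "orth_rank1_idempotents d (\<lambda>i. P * Delta d i * Q)"
proof -
  interpret vec_space "TYPE('a)" "Suc d" .
  have carr: "P * Delta d i * Q \<in> carrier_mat (Suc d) (Suc d)" for i
    by (rule mult_carrier_mat[OF mult_carrier_mat[OF P Delta_carrier] Q])
  have "(P * Delta d i * Q) * (P * Delta d j * Q) =
      (if i = j then P * Delta d i * Q else 0\<^sub>m (Suc d) (Suc d))"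
    if "i \<le> d" "j \<le> d" for i j
  proof -
    \<comment> \<open>The identity in the middle is what remains of \<open>Q * P\<close>; its entry
      \<open>(i, j)\<close> is the Kronecker delta.\<close>
    have "Delta d i * 1\<^sub>m (Suc d) * Delta d j =
        (if i = j then Delta d i else 0\<^sub>m (Suc d) (Suc d) :: 'a mat)"
      using that unfolding Delta_mult_Delta[OF one_carrier_mat that]
      by (auto simp: Delta_def)
    then show ?thesis
      using P Q by (simp add: mult_Delta_mult_Delta inv(2))
  qed
  moreover have "rank (P * Delta d i * Q) = 1" if i: "i \<le> d" for i
  proof -
    \<comment> \<open>The rank is squeezed: a nonzero matrix has rank at least 1, an outer product
      at most 1.\<close>
    have "P * Delta d i * Q \<noteq> 0\<^sub>m (Suc d) (Suc d)"
      using mult_eq_0_iff_of_inverses[OF Delta_carrier P Q inv] Delta_neq_0[OF i] by blast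
    then have "0 < rank (P * Delta d i * Q)"
      by (rule rank_pos[OF carr])
    moreover have "rank (P * Delta d i * Q) \<le> 1"
      by (rule rank_le_1_product_entries[OF carr, of _ "\<lambda>r. P $$ (r, i)" "\<lambda>s. Q $$ (i, s)"])
        (use mult_Delta_mult[OF P Q i] in simp)
    ultimately show ?thesis
      by simp
  qed
  ultimately show ?thesis
    using carr by (simp add: orth_rank1_idempotents_def)
qed

lemma orth_rank1_idempotents_Delta: "orth_rank1_idempotents d (Delta d :: nat \<Rightarrow> 'a::field mat)"
proof -
  have "1\<^sub>m (Suc d) * Delta d i * 1\<^sub>m (Suc d) = (Delta d i :: 'a mat)" for i
    by (simp add: left_mult_one_mat[OF Delta_carrier] right_mult_one_mat[OF Delta_carrier])
  then show ?thesis
    using orth_rank1_idempotents_conjugate_Delta[of "1\<^sub>m (Suc d)" d "1\<^sub>m (Suc d) :: 'a mat"]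
    by simp
qed

text \<open>Needed because \<open>E\<close> and \<open>Es\<close> are prescribed only at indices up
  to \<open>d\<close>, so they may differ as functions from the explicit sequences.\<close>

lemma orth_rank1_idempotents_cong:
  "(\<And>i. i \<le> d \<Longrightarrow> E i = F i) \<Longrightarrow> orth_rank1_idempotents d E \<longleftrightarrow> orth_rank1_idempotents d F"
  by (simp add: orth_rank1_idempotents_def)

theorem proposition4p5:
  fixes R :: "'a::field mat" and d :: nat and E Es :: "nat \<Rightarrow> 'a mat"
  assumes "R \<in> carrier_mat (Suc d) (Suc d)"
    and "invertible_mat R"
    and "\<And>i. i \<le> d \<Longrightarrow> E i = Delta d i"
    and "\<And>i. i \<le> d \<Longrightarrow> Es i = R * Delta d i * mat_inv R"
  shows "idempotent_system d E Es \<longleftrightarrow> solid d R"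
proof -
  note R = assms(1) and E = assms(3) and Es = assms(4)
  define S where "S = mat_inv R"
  note S = mat_inv[OF assms(1,2), folded S_def]
  note Es = Es[folded S_def]
  have "orth_rank1_idempotents d E"
    using orth_rank1_idempotents_Delta orth_rank1_idempotents_cong[of d E "Delta d"] E by blast
  moreover have "orth_rank1_idempotents d Es"
    using orth_rank1_idempotents_conjugate_Delta[OF R S]
      orth_rank1_idempotents_cong[of d Es "\<lambda>i. R * Delta d i * S"] Es
    by blast
  \<comment> \<open>Compressing by \<open>Delta d 0\<close> leaves only entry \<open>(0, 0)\<close>
    of \<open>Es i\<close>, which the outer product form gives as
    \<open>R $$ (0, i) * S $$ (i, 0)\<close>.\<close>
  moreover have "E 0 * Es i * E 0 = 0\<^sub>m (Suc d) (Suc d) \<longleftrightarrow> R $$ (0, i) * S $$ (i, 0) = 0"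
    if i: "i \<le> d" for i
  proof -
    have "R * Delta d i * S \<in> carrier_mat (Suc d) (Suc d)"
      by (rule mult_carrier_mat[OF mult_carrier_mat[OF R Delta_carrier] S(1)])
    then show ?thesis
      using i mult_Delta_mult[OF R S(1) i] by (simp add: E Es Delta_mult_Delta_eq_0_iff)
  qed
  moreover have "Es 0 * E i * Es 0 = 0\<^sub>m (Suc d) (Suc d) \<longleftrightarrow> S $$ (0, i) * R $$ (i, 0) = 0"
    if i: "i \<le> d" for i
  proof -
    let ?M = "S * Delta d i * R"
    have M: "?M \<in> carrier_mat (Suc d) (Suc d)"
      by (rule mult_carrier_mat[OF mult_carrier_mat[OF S(1) Delta_carrier] R])
    \<comment> \<open>Expanding both copies of \<open>Es 0\<close> and regrouping gives a conjugate
      by \<open>R\<close> of the previous situation, with the roles of \<open>R\<close> and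
      \<open>S\<close> exchanged inside \<open>?M\<close>.\<close>
    have "Es 0 * E i * Es 0 = R * (Delta d 0 * ?M * Delta d 0) * S"
      using i R S(1)
      by (simp add: E Es assoc_mult_mat[of _ "Suc d" "Suc d" _ "Suc d" _ "Suc d"]
          mult_carrier_mat[of _ "Suc d" "Suc d" _ "Suc d"])
    also have "\<dots> = 0\<^sub>m (Suc d) (Suc d) \<longleftrightarrow> Delta d 0 * ?M * Delta d 0 = 0\<^sub>m (Suc d) (Suc d)"
      by (rule mult_eq_0_iff_of_inverses[OF _ R S])
        (rule mult_carrier_mat[OF mult_carrier_mat[OF Delta_carrier M] Delta_carrier])
    also have "\<dots> \<longleftrightarrow> ?M $$ (0, 0) = 0"
      using M by (intro Delta_mult_Delta_eq_0_iff) auto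
    finally show ?thesis
      using i mult_Delta_mult[OF S(1) R i] by simp
  qed
  ultimately show ?thesis
    \<comment> \<open>In a field a product is nonzero iff both factors are, so the two families of
      conditions split into nonzero row 0 and column 0 of both \<open>R\<close> and
      \<open>S\<close>.\<close>
    using assms(1,2) by (auto simp: idempotent_system_def solid_def S_def[symmetric])
qed

end
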